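(* Let $\mathbf{X}$ be a spectrally positive Lévy process of unbounded variation with characteristic exponent $\psi$ and Laplace exponent $\varphi$, and let $x_0\ge0$ and $\alpha>0$. Then $\varphi''\in\mathrm{WLSC}(\alpha-2,c,x_0)$ for some $c\in(0,1]$ if and only if $\mathrm{Re}\,\psi\in\mathrm{WLSC}(\alpha,\tilde c,x_0)$ for some $\tilde c\in(0,1]$.
   Context: A spectrally positive Lévy process is a Lévy process on $\mathbb{R}$ with only positive jumps. There are $\sigma\ge 0$, $b\in\mathbb{R}$ and a $\sigma$-finite measure $\nu$ on $(0,\infty)$ with $\int_{(0,\infty)}(1\wedge x^2)\,\nu(dx)<\infty$ such that $\mathbb{E}e^{i\xi X_t}=e^{-t\psi(\xi)}$ and $\mathbb{E}e^{-\lambda X_t}=e^{t\varphi(\lambda)}$ ($\xi\in\mathbb{R}$, $\lambda\ge0$), where $$\psi(\xi)=\sigma^2\xi^2-i\xi b-\int_{(0,\infty)}\big(e^{i\xi x}-1-i\xi x\mathbf{1}_{x<1}\big)\nu(dx),\qquad \varphi(\lambda)=\sigma^2\lambda^2-b\lambda+\int_{(0,\infty)}\big(e^{-\lambda x}-1+\lambda x\mathbf{1}_{x<1}\big)\nu(dx).$$ Unbounded variation (a standing assumption) means that $\sigma>0$ or $\int_{(0,1)}x\,\nu(dx)=\infty$. Scaling: a nonnegative function $f$ belongs to $\mathrm{WLSC}(\alpha,c,x_1)$ if $f(\lambda x)\ge c\lambda^{\alpha}f(x)$ for all $\lambda\ge1$ and $x>x_1$. *)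

theory Defs
  imports "HOL-Probability.Probability"
begin

text \<open>Time is \<open>[0, \<infinity>)\<close>: values of \<open>X t\<close> for \<open>t < 0\<close> are irrelevant. Stochastic continuity
  follows from right-continuity together with stationarity of the increments.\<close>

locale levy_process = prob_space M
  for M :: "'a measure" and X :: "real \<Rightarrow> 'a \<Rightarrow> real" +
  assumes random_variable_X: "\<And>t. t \<ge> 0 \<Longrightarrow> random_variable borel (X t)"
    and start_zero: "AE \<omega> in M. X 0 \<omega> = 0"
    and independent_increments:
      "\<And>(\<tau> :: nat \<Rightarrow> real) n. mono \<tau> \<Longrightarrow> \<tau> 0 \<ge> 0 \<Longrightarrow>
         indep_vars (\<lambda>_. borel) (\<lambda>i \<omega>. X (\<tau> (Suc i)) \<omega> - X (\<tau> i) \<omega>) {..<n}"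
    and stationary_increments:
      "\<And>s h. s \<ge> 0 \<Longrightarrow> h \<ge> 0 \<Longrightarrow>
         distr M borel (\<lambda>\<omega>. X (s + h) \<omega> - X s \<omega>) = distr M borel (X h)"
    and cadlag_right:
      "AE \<omega> in M. \<forall>t\<ge>0. continuous (at_right t) (\<lambda>s. X s \<omega>)"
    and cadlag_left:
      "AE \<omega> in M. \<forall>t>0. \<exists>l. ((\<lambda>s. X s \<omega>) \<longlongrightarrow> l) (at_left t)"

text \<open>``Only positive jumps'' means that no jump is negative; continuous paths (\<open>\<nu> = 0\<close>) are
  allowed.\<close>

locale spectrally_positive_levy_process = levy_process +
  assumes no_negative_jumps:
    "AE \<omega> in M. \<forall>t>0. \<forall>l. ((\<lambda>s. X s \<omega>) \<longlongrightarrow> l) (at_left t) \<longrightarrow> l \<le> X t \<omega>"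

definition levy_measure :: "real measure \<Rightarrow> bool" where
  "levy_measure \<nu> \<longleftrightarrow>
     sigma_finite_measure \<nu> \<and> sets \<nu> = sets (restrict_space borel {0<..}) \<and>
     (\<integral>\<^sup>+ x. ennreal (min 1 (x\<^sup>2)) \<partial>\<nu>) < \<infinity>"

definition char_exponent :: "real \<Rightarrow> real \<Rightarrow> real measure \<Rightarrow> real \<Rightarrow> complex" where
  "char_exponent \<sigma> b \<nu> \<xi> =
     of_real (\<sigma>\<^sup>2 * \<xi>\<^sup>2) - \<i> * of_real \<xi> * of_real b
     - (\<integral>x. (exp (\<i> * of_real (\<xi> * x)) - 1 - \<i> * of_real (\<xi> * x * indicator {..<1} x)) \<partial>\<nu>)"

text \<open>Only \<open>\<lambda> \<ge> 0\<close> is meaningful; for \<open>\<lambda> < 0\<close> the integral may fail to exist.\<close>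

definition laplace_exponent :: "real \<Rightarrow> real \<Rightarrow> real measure \<Rightarrow> real \<Rightarrow> real" where
  "laplace_exponent \<sigma> b \<nu> l =
     \<sigma>\<^sup>2 * l\<^sup>2 - b * l
     + (\<integral>x. (exp (- l * x) - 1 + l * x * indicator {..<1} x) \<partial>\<nu>)"

text \<open>Both exponential moments are Bochner integrals, which are \<open>0\<close> for non-integrable
  functions; since the right-hand sides do not vanish, the equations include integrability.\<close>

definition levy_triplet ::
    "'a measure \<Rightarrow> (real \<Rightarrow> 'a \<Rightarrow> real) \<Rightarrow> real \<Rightarrow> real \<Rightarrow> real measure \<Rightarrow> bool" where
  "levy_triplet M X \<sigma> b \<nu> \<longleftrightarrow>
     \<sigma> \<ge> 0 \<and> levy_measure \<nu> \<and>
     (\<forall>t\<ge>0. \<forall>\<xi>. (\<integral>\<omega>. exp (\<i> * of_real (\<xi> * X t \<omega>)) \<partial>M)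
                   = exp (- of_real t * char_exponent \<sigma> b \<nu> \<xi>)) \<and>
     (\<forall>t\<ge>0. \<forall>l\<ge>0. (\<integral>\<omega>. exp (- l * X t \<omega>) \<partial>M) = exp (t * laplace_exponent \<sigma> b \<nu> l))"

definition unbounded_variation :: "real \<Rightarrow> real measure \<Rightarrow> bool" where
  "unbounded_variation \<sigma> \<nu> \<longleftrightarrow> \<sigma> > 0 \<or> (\<integral>\<^sup>+ x\<in>{0<..<1}. ennreal x \<partial>\<nu>) = \<infinity>"

text \<open>Functions on \<open>(0, \<infinity>)\<close> are represented by functions on the reals; values at non-positive
  arguments play no role when \<open>x1 \<ge> 0\<close>.\<close>

definition WLSC :: "real \<Rightarrow> real \<Rightarrow> real \<Rightarrow> (real \<Rightarrow> real) set" where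
  "WLSC \<alpha> c x1 =
     {f. (\<forall>x>0. f x \<ge> 0) \<and> (\<forall>l\<ge>1. \<forall>x>x1. f (l * x) \<ge> c * l powr \<alpha> * f x)}"

end

theory Submission
  imports Defs
begin

text \<open>
  On the positive half-line both functions are, up to a constant factor, caught between the same
  two quantities attached to \<open>(\<sigma>, \<nu>)\<close>: the truncated variance
  \<open>K x = \<sigma>\<^sup>2 x\<^sup>2 + \<integral>\<^sub>{x u \<le> 1} (x u)\<^sup>2 \<nu>(du)\<close> and the concentration function
  \<open>h x = \<sigma>\<^sup>2 x\<^sup>2 + \<integral> min 1 ((x u)\<^sup>2) \<nu>(du)\<close>. Indeed
  \<open>Re \<psi> x = \<sigma>\<^sup>2 x\<^sup>2 + \<integral> (1 - cos (x u)) \<nu>(du)\<close> and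
  \<open>x\<^sup>2 \<phi>'' x = 2 \<sigma>\<^sup>2 x\<^sup>2 + \<integral> (x u)\<^sup>2 exp (- x u) \<nu>(du)\<close>, and both integrands, as functions of \<open>v = x u\<close>,
  lie above \<open>v\<^sup>2 / 3\<close> on \<open>(0, 1]\<close> and below \<open>2 min 1 (v\<^sup>2)\<close> everywhere. This alone
  does not make them comparable, as \<open>K\<close> may be much smaller than \<open>h\<close>. Lower scaling of positive order
  does, above the threshold \<open>x0\<close>.

  The link between \<open>K\<close> and \<open>h\<close> is \<open>h (l x) \<le> h x + l\<^sup>2 K x\<close> for \<open>l \<ge> 1\<close>: enlarging \<open>x\<close> changes the
  integrand of \<open>h\<close> only where \<open>x u < 1\<close>. Now let \<open>Q\<close> be any function with \<open>a K \<le> Q \<le> b h\<close>.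

  If \<open>Q\<close> has lower scaling of order \<open>\<alpha> > 0\<close>, then summing the increments of \<open>h\<close> along
  \<open>x, x/2, x/4, \<dots>\<close> bounds \<open>h x - h (x / 2\<^sup>n)\<close> by \<open>(4 / a) (Q (x/2) + Q (x/4) + \<dots>)\<close>, which is at most
  a geometric series times \<open>Q x\<close>. Hence \<open>h \<le> C Q\<close>, so \<open>Q\<close> and \<open>h\<close> are comparable and \<open>h\<close> inherits
  the scaling (\<open>h_le_of_scaling\<close>).

  If \<open>h\<close> has lower scaling, fix \<open>l\<close> so large that \<open>h (l x) \<ge> 2 h x\<close>. The increment bound then gives
  \<open>h x \<le> l\<^sup>2 K x\<close>, so \<open>K\<close>, \<open>Q\<close> and \<open>h\<close> are all comparable and \<open>Q\<close> inherits the scaling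
  (\<open>h_le_K_of_scaling\<close>).

  So lower scaling of \<open>Re \<psi>\<close> and lower scaling of \<open>x\<^sup>2 \<phi>'' x\<close> are both equivalent to lower scaling of
  \<open>h\<close> (\<open>lower_scaling_levy_integral_iff\<close>). Unbounded variation enters through the positivity of \<open>K\<close>:
  arbitrarily small jumps, or a Gaussian part, exclude that \<open>Q\<close> degenerates near the threshold \<open>x0\<close>.
\<close>


section \<open>Lower scaling\<close>

definition lower_scaling :: "real \<Rightarrow> real \<Rightarrow> (real \<Rightarrow> real) \<Rightarrow> bool" where
  "lower_scaling \<alpha> x0 f \<longleftrightarrow> (\<exists>c. 0 < c \<and> c \<le> 1 \<and> f \<in> WLSC \<alpha> c x0)"

lemma lower_scaling_of_comparable:
  fixes f g :: "real \<Rightarrow> real"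
  assumes f: "lower_scaling \<alpha> x0 f" and "0 \<le> x0"
    and A: "0 < A" "\<And>x. x0 < x \<Longrightarrow> f x \<le> A * g x"
    and B: "0 < B" "\<And>x. x0 < x \<Longrightarrow> g x \<le> B * f x"
    and g: "\<And>x. 0 < x \<Longrightarrow> 0 \<le> g x"
  shows "lower_scaling \<alpha> x0 g"
proof -
  from f obtain c where c: "0 < c" and f_scaling:
      "\<And>l x. 1 \<le> l \<Longrightarrow> x0 < x \<Longrightarrow> c * l powr \<alpha> * f x \<le> f (l * x)"
    by (auto simp: lower_scaling_def WLSC_def)
  define d where "d = min 1 (c / (A * B))"
  have d: "0 < d" "d \<le> 1" "d \<le> c / (A * B)"
    using c A B by (auto simp: d_def)
  have "d * l powr \<alpha> * g x \<le> g (l * x)" if "1 \<le> l" "x0 < x" for l x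
  proof -
    have "1 * x \<le> l * x"
      using that \<open>0 \<le> x0\<close> by (intro mult_right_mono) auto
    then have lx: "x0 < l * x"
      using that by simp
    have "d * l powr \<alpha> * g x \<le> c / (A * B) * l powr \<alpha> * (B * f x)"
      using d c A B g[of x] B(2)[of x] that \<open>0 \<le> x0\<close> by (intro mult_mono) auto
    also have "\<dots> = (c * l powr \<alpha> * f x) / A"
      using B by (simp add: field_simps)
    also have "\<dots> \<le> f (l * x) / A"
      using f_scaling[OF that] A by (intro divide_right_mono) auto
    also have "\<dots> \<le> g (l * x)"
      using A(2)[OF lx] A(1) by (simp add: field_simps)
    finally show ?thesis .
  qed
  with d g show ?thesis
    unfolding lower_scaling_def WLSC_def by auto
qed

text \<open>Multiplication by \<open>x\<^sup>2\<close> raises the order by 2 and keeps the constant, so that \<open>\<phi>''\<close> can be traded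
  for \<open>x\<^sup>2 \<phi>'' x\<close>, which obeys the same two-sided bounds as \<open>Re \<psi> x\<close>.\<close>

lemma square_times_WLSC_iff:
  fixes f :: "real \<Rightarrow> real"
  assumes "0 \<le> x0"
  shows "(\<lambda>x. x\<^sup>2 * f x) \<in> WLSC \<alpha> c x0 \<longleftrightarrow> f \<in> WLSC (\<alpha> - 2) c x0"
proof -
  have "c * l powr \<alpha> * (x\<^sup>2 * f x) \<le> (l * x)\<^sup>2 * f (l * x) \<longleftrightarrow>
      c * l powr (\<alpha> - 2) * f x \<le> f (l * x)" if "1 \<le> l" "x0 < x" for l x
  proof -
    have "l powr \<alpha> = l powr (\<alpha> - 2) * l\<^sup>2"
      using that powr_add[of l "\<alpha> - 2" 2] by simp
    then have "c * l powr \<alpha> * (x\<^sup>2 * f x) = (l * x)\<^sup>2 * (c * l powr (\<alpha> - 2) * f x)"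
      by (simp add: power_mult_distrib)
    moreover have "0 < (l * x)\<^sup>2"
      using that assms by simp
    ultimately show ?thesis
      by (simp only: mult_le_cancel_left_pos)
  qed
  then show ?thesis
    by (auto simp: WLSC_def zero_le_mult_iff)
qed


section \<open>Scaling of functions between the truncated variance and the concentration function\<close>

lemma ex_dyadic_quotient:
  fixes x y :: real
  assumes "0 < y" "y < x"
  shows "\<exists>n. y < x / 2 ^ n \<and> x / 2 ^ n \<le> 2 * y"
proof -
  obtain m where "x / y < 2 ^ m"
    using real_arch_pow[of 2 "x / y"] by auto
  then have m: "x / 2 ^ m \<le> 2 * y"
    using assms by (simp add: field_simps)
  define n where "n = (LEAST n. x / 2 ^ n \<le> 2 * y)"
  have "x / 2 ^ n \<le> 2 * y"
    unfolding n_def using m by (rule LeastI)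
  moreover have "y < x / 2 ^ n"
  proof (cases n)
    case 0
    with assms show ?thesis
      by simp
  next
    case (Suc k)
    then have "\<not> x / 2 ^ k \<le> 2 * y"
      using not_less_Least[of k "\<lambda>n. x / 2 ^ n \<le> 2 * y"] by (simp add: n_def)
    with Suc show ?thesis
      by simp
  qed
  ultimately show ?thesis
    by blast
qed

text \<open>The properties of the truncated variance \<open>K\<close> and the concentration function \<open>h\<close> of a Levy measure
  on which the scaling argument rests. The last one drives both directions.\<close>

locale concentration_pair =
  fixes K h :: "real \<Rightarrow> real"
  assumes K_pos: "0 < x \<Longrightarrow> 0 < K x"
    and K_ratio: "0 < x \<Longrightarrow> x \<le> y \<Longrightarrow> K y \<le> (y / x)\<^sup>2 * K x"
    and h_nonneg: "0 \<le> h x"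
    and h_mono: "0 < x \<Longrightarrow> x \<le> y \<Longrightarrow> h x \<le> h y"
    and h_at_0: "(h \<longlongrightarrow> 0) (at_right 0)"
    and h_increment: "0 < x \<Longrightarrow> 1 \<le> l \<Longrightarrow> h (l * x) \<le> h x + l\<^sup>2 * K x"
begin

lemma h_dyadic: "0 < x \<Longrightarrow> h x \<le> h (x / 2 ^ n) + 4 * (\<Sum>k<n. K (x / 2 ^ Suc k))"
proof (induction n)
  case (Suc n)
  have "h (2 * (x / 2 ^ Suc n)) \<le> h (x / 2 ^ Suc n) + 2\<^sup>2 * K (x / 2 ^ Suc n)"
    by (rule h_increment) (use Suc.prems in auto)
  with Suc.IH[OF Suc.prems] show ?case
    by (simp add: algebra_simps)
qed simp

text \<open>Scaling at \<open>x / 2\<^sup>k\<close> reads \<open>Q (x / 2\<^sup>k) \<le> 2\<^sup>-\<^sup>k\<^sup>\<alpha> Q x / c\<close>, so the dyadic sum of \<open>K \<le> Q / a\<close> is geometric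
  as long as the points stay above \<open>x0\<close>. What is left is \<open>h\<close> at the last point. For \<open>x0 = 0\<close> it tends to
  \<open>0\<close>. For \<open>x0 > 0\<close> one stops in \<open>(x0, 2 x0]\<close>, where \<open>h \<le> h (2 x0)\<close> and \<open>Q \<ge> a K \<ge> a K (2 x0) / 4\<close>; by
  scaling the latter persists, up to \<open>c\<close>, as a lower bound of \<open>Q\<close> on all of \<open>(x0, \<infinity>)\<close>.\<close>

lemma h_le_of_scaling:
  assumes scaling: "lower_scaling \<alpha> x0 Q" and "0 < \<alpha>" "0 \<le> x0"
    and a: "0 < a" "\<And>x. 0 < x \<Longrightarrow> a * K x \<le> Q x"
  shows "\<exists>C>0. \<forall>x>x0. h x \<le> C * Q x"
proof -
  from scaling obtain c where c: "0 < c" and Q_scaling: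
      "\<And>l x. 1 \<le> l \<Longrightarrow> x0 < x \<Longrightarrow> c * l powr \<alpha> * Q x \<le> Q (l * x)"
    by (auto simp: lower_scaling_def WLSC_def)
  define r :: real where "r = 2 powr (- \<alpha>)"
  have r: "0 < r" "r < 1"
    using \<open>0 < \<alpha>\<close> by (auto simp: r_def powr_less_one)
  have Q_pos: "0 < Q x" if "0 < x" for x
    using a(2)[OF that] K_pos[OF that] a(1) by (meson less_le_trans mult_pos_pos)
  have Q_dyadic: "Q (x / 2 ^ n) \<le> r ^ n / c * Q x" if "x0 < x / 2 ^ n" for x n
  proof -
    have "c * (2 ^ n) powr \<alpha> * Q (x / 2 ^ n) \<le> Q (2 ^ n * (x / 2 ^ n))"
      by (rule Q_scaling) (use that in auto)
    moreover have "(2 ^ n) powr \<alpha> = 1 / r ^ n"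
      by (simp add: r_def powr_minus powr_realpow[symmetric] powr_powr powr_power
          power_inverse field_simps mult.commute)
    ultimately show ?thesis
      using r c by (simp add: field_simps)
  qed
  define D where "D = 4 / (a * c * (1 - r))"
  have D: "0 < D"
    using a c r by (simp add: D_def)
  have h_le: "h x \<le> h (x / 2 ^ n) + D * Q x" if "x0 < x / 2 ^ n" for x n
  proof -
    have below: "x0 < x / 2 ^ k" if "k \<le> n" for k
    proof -
      have "0 < x / 2 ^ n"
        using \<open>x0 < x / 2 ^ n\<close> \<open>0 \<le> x0\<close> by simp
      then have "0 < x"
        by (simp add: zero_less_divide_iff)
      then have "x / 2 ^ n \<le> x / 2 ^ k"
        using that by (intro divide_left_mono) auto
      with \<open>x0 < x / 2 ^ n\<close> show ?thesis
        by simp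
    qed
    have x: "0 < x"
      using below[of 0] \<open>0 \<le> x0\<close> by simp
    have "(\<Sum>k<n. K (x / 2 ^ Suc k)) \<le> (\<Sum>k<n. r ^ k * (Q x / (a * c)))"
    proof (intro sum_mono)
      fix k assume "k \<in> {..<n}"
      then have "Q (x / 2 ^ Suc k) \<le> r ^ Suc k / c * Q x"
        by (intro Q_dyadic below) auto
      also have "\<dots> \<le> r ^ k / c * Q x"
        using r c Q_pos[OF x] by (intro mult_right_mono divide_right_mono power_decreasing) auto
      finally have "a * K (x / 2 ^ Suc k) \<le> r ^ k / c * Q x"
        using a(2)[of "x / 2 ^ Suc k"] x by auto
      then show "K (x / 2 ^ Suc k) \<le> r ^ k * (Q x / (a * c))"
        using a(1) c by (simp add: field_simps)
    qed
    also have "\<dots> = (\<Sum>k<n. r ^ k) * (Q x / (a * c))"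
      by (rule sum_distrib_right[symmetric])
    also have "\<dots> \<le> 1 / (1 - r) * (Q x / (a * c))"
    proof (rule mult_right_mono)
      show "(\<Sum>k<n. r ^ k) \<le> 1 / (1 - r)"
        using r sum_le_suminf[of "\<lambda>k. r ^ k" "{..<n}"] by (simp add: suminf_geometric)
      show "0 \<le> Q x / (a * c)"
        using Q_pos[OF x] a(1) c by simp
    qed
    also have "\<dots> = D * Q x / 4"
      by (simp add: D_def)
    finally show ?thesis
      using h_dyadic[OF x, of n] by simp
  qed
  show ?thesis
  proof (cases "x0 = 0")
    case True
    have "h x \<le> D * Q x" if "0 < x" for x
    proof -
      have "(\<lambda>n. x / 2 ^ n) \<longlonglongrightarrow> 0"
        by (rule LIMSEQ_divide_realpow_zero) simp
      then have "filterlim (\<lambda>n. x / 2 ^ n) (at_right 0) sequentially"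
        using that by (auto simp: filterlim_at)
      then have "(\<lambda>n. h (x / 2 ^ n) + D * Q x) \<longlonglongrightarrow> 0 + D * Q x"
        by (intro tendsto_intros filterlim_compose[OF h_at_0])
      moreover have "h x \<le> h (x / 2 ^ n) + D * Q x" for n
        using h_le[of x n] that True by simp
      ultimately have "h x \<le> 0 + D * Q x"
        by (intro LIMSEQ_le_const) auto
      then show ?thesis
        by simp
    qed
    with D True show ?thesis
      by auto
  next
    case False
    with \<open>0 \<le> x0\<close> have x0: "0 < x0"
      by simp
    define q where "q = a * K (2 * x0) / 4"
    have q: "0 < q"
      using a(1) K_pos[of "2 * x0"] x0 by (simp add: q_def)
    have q_le: "q \<le> Q y" if "x0 < y" "y \<le> 2 * x0" for y
    proof -
      have "0 < y"
        using that x0 by simp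
      have "K (2 * x0) \<le> (2 * x0 / y)\<^sup>2 * K y"
        using that x0 by (intro K_ratio) auto
      also have "\<dots> \<le> 2\<^sup>2 * K y"
        using that x0 K_pos[OF \<open>0 < y\<close>]
        by (intro mult_right_mono power_mono) (auto simp: field_simps)
      finally have "q \<le> a * K y"
        using a(1) by (simp add: q_def)
      also have "\<dots> \<le> Q y"
        by (rule a(2)) fact
      finally show ?thesis .
    qed
    define E where "E = h (2 * x0) / (c * q)"
    have "h x \<le> (D + E) * Q x" if x: "x0 < x" for x
    proof -
      obtain n where n: "x0 < x / 2 ^ n" "x / 2 ^ n \<le> 2 * x0"
        using ex_dyadic_quotient[OF x0 x] by blast
      have "q \<le> r ^ n / c * Q x"
        using q_le[OF n] Q_dyadic[OF n(1)] by simp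
      also have "\<dots> \<le> 1 / c * Q x"
        using r c Q_pos[of x] x x0
        by (intro mult_right_mono divide_right_mono power_le_one) auto
      finally have "1 \<le> Q x / (c * q)"
        using c q by (simp add: field_simps)
      then have "h (2 * x0) * 1 \<le> h (2 * x0) * (Q x / (c * q))"
        using h_nonneg by (intro mult_left_mono)
      then have "h (2 * x0) \<le> E * Q x"
        by (simp add: E_def)
      moreover have "h (x / 2 ^ n) \<le> h (2 * x0)"
        using n x0 by (intro h_mono) auto
      ultimately show ?thesis
        using h_le[OF n(1)] by (simp add: algebra_simps)
    qed
    moreover have "0 \<le> E"
      using h_nonneg c q by (simp add: E_def)
    ultimately show ?thesis
      using D by (intro exI[of _ "D + E"]) auto
  qed
qed

text \<open>If \<open>c l\<^sup>\<alpha> = 2\<close> then \<open>2 h x \<le> h (l x) \<le> h x + l\<^sup>2 K x\<close>.\<close>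

lemma h_le_K_of_scaling:
  assumes scaling: "lower_scaling \<alpha> x0 h" and "0 < \<alpha>" "0 \<le> x0"
  shows "\<exists>C>0. \<forall>x>x0. h x \<le> C * K x"
proof -
  from scaling obtain c where c: "0 < c" "c \<le> 1" and h_scaling:
      "\<And>l x. 1 \<le> l \<Longrightarrow> x0 < x \<Longrightarrow> c * l powr \<alpha> * h x \<le> h (l * x)"
    by (auto simp: lower_scaling_def WLSC_def)
  define l where "l = (2 / c) powr (1 / \<alpha>)"
  have l: "1 \<le> l"
    using c \<open>0 < \<alpha>\<close> by (auto simp: l_def intro!: ge_one_powr_ge_zero)
  have l_powr: "c * l powr \<alpha> = 2"
    using c \<open>0 < \<alpha>\<close> by (simp add: l_def powr_powr)
  have "h x \<le> l\<^sup>2 * K x" if "x0 < x" for x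
    using h_scaling[OF l that] h_increment[of x l] l l_powr that \<open>0 \<le> x0\<close> by simp
  with l show ?thesis
    by (intro exI[of _ "l\<^sup>2"]) auto
qed

text \<open>A function between \<open>K\<close> and \<open>h\<close> need not be comparable to \<open>h\<close>, but scaling of either of the two
  forces this, and comparable functions share their scaling.\<close>

theorem lower_scaling_iff:
  assumes "0 < \<alpha>" "0 \<le> x0"
    and a: "0 < a" "\<And>x. 0 < x \<Longrightarrow> a * K x \<le> Q x"
    and b: "0 < b" "\<And>x. 0 < x \<Longrightarrow> Q x \<le> b * h x"
  shows "lower_scaling \<alpha> x0 Q \<longleftrightarrow> lower_scaling \<alpha> x0 h"
proof
  assume Q: "lower_scaling \<alpha> x0 Q"
  then obtain C where "0 < C" "\<forall>x>x0. h x \<le> C * Q x"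
    using h_le_of_scaling assms by metis
  then show "lower_scaling \<alpha> x0 h"
    using lower_scaling_of_comparable[OF Q \<open>0 \<le> x0\<close> b(1)] b(2) h_nonneg assms by force
next
  assume h: "lower_scaling \<alpha> x0 h"
  then obtain C where C: "0 < C" "\<forall>x>x0. h x \<le> C * K x"
    using h_le_K_of_scaling assms by metis
  have "h x \<le> C / a * Q x" if "x0 < x" for x
  proof -
    have "h x \<le> C / a * (a * K x)"
      using C that a(1) by simp
    also have "\<dots> \<le> C / a * Q x"
      using C a that assms(2) by (intro mult_left_mono) auto
    finally show ?thesis .
  qed
  moreover have "0 \<le> Q x" if "0 < x" for x
    using a(2)[OF that] K_pos[OF that] a(1) by (meson less_imp_le less_le_trans mult_pos_pos)
  ultimately show "lower_scaling \<alpha> x0 Q"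
    using lower_scaling_of_comparable[OF h \<open>0 \<le> x0\<close>, of "C / a" Q b] a(1) b C assms(2) by force
qed

end


section \<open>Integration against a Levy measure\<close>

lemma borel_measurable_levy_measure:
  assumes "levy_measure \<nu>" and "f \<in> borel_measurable borel"
  shows "f \<in> borel_measurable \<nu>"
proof -
  have sets: "sets \<nu> = sets (restrict_space borel {0<..})"
    using assms by (simp add: levy_measure_def)
  show ?thesis
    unfolding measurable_cong_sets[OF sets refl]
    by (rule measurable_restrict_space1) (rule assms)
qed

lemma space_levy_measure:
  assumes "levy_measure \<nu>"
  shows "space \<nu> = {0<..}"
proof -
  have "sets \<nu> = sets (restrict_space borel {0<..})"
    using assms by (simp add: levy_measure_def)
  then show ?thesis
    by (auto dest: sets_eq_imp_space_eq simp: space_restrict_space)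
qed

lemma integrable_min_square:
  assumes "levy_measure \<nu>"
  shows "integrable \<nu> (\<lambda>u. min 1 (u\<^sup>2))"
  using assms
  by (intro integrableI_nonneg borel_measurable_levy_measure[OF assms])
     (auto simp: levy_measure_def)

text \<open>Domination by a multiple of \<open>min 1 (u\<^sup>2)\<close> is why all integrals against \<open>\<nu>\<close> below converge.\<close>

lemma integrable_levy_measure:
  fixes f :: "real \<Rightarrow> 'b :: {banach, second_countable_topology}"
  assumes "levy_measure \<nu>" and "f \<in> borel_measurable borel"
    and "\<And>u. 0 < u \<Longrightarrow> norm (f u) \<le> C * min 1 (u\<^sup>2)"
  shows "integrable \<nu> f"
proof (rule Bochner_Integration.integrable_bound)
  show "integrable \<nu> (\<lambda>u. C * min 1 (u\<^sup>2))"
    by (intro integrable_mult_right integrable_min_square assms)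
  show "f \<in> borel_measurable \<nu>"
    by (rule borel_measurable_levy_measure[OF assms(1,2)])
  show "AE u in \<nu>. norm (f u) \<le> norm (C * min 1 (u\<^sup>2))"
    using order_trans[OF assms(3) abs_ge_self]
    by (intro AE_I2) (simp add: space_levy_measure[OF assms(1)])
qed

lemma min_square_scaled_le:
  fixes x u :: real
  shows "min 1 ((x * u)\<^sup>2) \<le> max 1 (x\<^sup>2) * min 1 (u\<^sup>2)"
proof (cases "u\<^sup>2 \<le> 1")
  case True
  then show ?thesis
    by (simp add: power_mult_distrib mult_right_mono min.coboundedI2)
next
  case False
  then show ?thesis
    by (simp add: min.coboundedI1)
qed

text \<open>Pruitt's functions \<open>K\<close> and \<open>h\<close> of the Levy measure, with the Gaussian part included and written in
  the frequency \<open>x\<close>, the reciprocal of the truncation radius.\<close>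

definition truncated_variance :: "real \<Rightarrow> real measure \<Rightarrow> real \<Rightarrow> real" where
  "truncated_variance \<sigma> \<nu> x = \<sigma>\<^sup>2 * x\<^sup>2 + (\<integral>u. (if x * u \<le> 1 then (x * u)\<^sup>2 else 0) \<partial>\<nu>)"

definition concentration :: "real \<Rightarrow> real measure \<Rightarrow> real \<Rightarrow> real" where
  "concentration \<sigma> \<nu> x = \<sigma>\<^sup>2 * x\<^sup>2 + (\<integral>u. min 1 ((x * u)\<^sup>2) \<partial>\<nu>)"

lemma integrable_min_scaled:
  assumes "levy_measure \<nu>"
  shows "integrable \<nu> (\<lambda>u. min 1 ((x * u)\<^sup>2))"
  by (rule integrable_levy_measure[OF assms, of _ "max 1 (x\<^sup>2)"])
     (auto simp: min_square_scaled_le)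

lemma integrable_truncated:
  assumes "levy_measure \<nu>" "0 < x"
  shows "integrable \<nu> (\<lambda>u. if x * u \<le> 1 then (x * u)\<^sup>2 else 0)"
proof (rule integrable_levy_measure[OF assms(1), of _ "max 1 (x\<^sup>2)"])
  show "(\<lambda>u. if x * u \<le> 1 then (x * u)\<^sup>2 else 0 :: real) \<in> borel_measurable borel"
    by measurable
  show "norm (if x * u \<le> 1 then (x * u)\<^sup>2 else 0 :: real) \<le> max 1 (x\<^sup>2) * min 1 (u\<^sup>2)"
    if "0 < u" for u
  proof -
    have "norm (if x * u \<le> 1 then (x * u)\<^sup>2 else 0 :: real) \<le> min 1 ((x * u)\<^sup>2)"
      using that assms(2) by (auto simp: abs_square_le_1)
    also note min_square_scaled_le
    finally show ?thesis .
  qed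
qed

text \<open>Without a Gaussian part, a vanishing truncated variance would mean that \<open>\<nu>\<close> has no mass on
  \<open>(0, 1 / x]\<close>. Then the jumps would be bounded away from 0 and \<open>\<integral>\<^sub>{(0,1)} u \<nu>(du)\<close> finite.\<close>

lemma truncated_variance_pos:
  assumes \<nu>: "levy_measure \<nu>" and ubv: "unbounded_variation \<sigma> \<nu>" and "0 < x"
  shows "0 < truncated_variance \<sigma> \<nu> x"
proof -
  let ?f = "\<lambda>u. if x * u \<le> 1 then (x * u)\<^sup>2 else 0 :: real"
  have nonneg: "0 \<le> (\<integral>u. ?f u \<partial>\<nu>)"
    by (rule Bochner_Integration.integral_nonneg) simp
  show ?thesis
  proof (cases "0 < \<sigma>")
    case True
    with nonneg \<open>0 < x\<close> show ?thesis
      by (simp add: truncated_variance_def add_pos_nonneg)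
  next
    case False
    with ubv have inf: "(\<integral>\<^sup>+ u\<in>{0<..<1}. ennreal u \<partial>\<nu>) = \<infinity>"
      by (simp add: unbounded_variation_def)
    have "(\<integral>u. ?f u \<partial>\<nu>) \<noteq> 0"
    proof
      assume "(\<integral>u. ?f u \<partial>\<nu>) = 0"
      then have "AE u in \<nu>. ?f u = 0"
        using integral_nonneg_eq_0_iff_AE[OF integrable_truncated[OF \<nu> \<open>0 < x\<close>]] by simp
      moreover have "AE u in \<nu>. 0 < u"
        by (rule AE_I2) (simp add: space_levy_measure[OF \<nu>])
      ultimately have ae: "AE u in \<nu>. 1 < x * u"
        by eventually_elim (use \<open>0 < x\<close> in \<open>auto simp: indicator_def split: if_splits\<close>)
      have "(\<integral>\<^sup>+ u\<in>{0<..<1}. ennreal u \<partial>\<nu>) \<le>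
          (\<integral>\<^sup>+ u. ennreal (max 1 (x\<^sup>2) * min 1 (u\<^sup>2)) \<partial>\<nu>)"
      proof (rule nn_integral_mono_AE)
        show "AE u in \<nu>. ennreal u * indicator {0<..<1} u \<le> ennreal (max 1 (x\<^sup>2) * min 1 (u\<^sup>2))"
          using ae
        proof eventually_elim
          case (elim u)
          \<comment> \<open>Here \<open>x u > 1\<close>, so the right-hand side is at least 1, and only \<open>u < 1\<close> counts on the left.\<close>
          have "u * indicator {0<..<1} u \<le> 1"
            by (auto simp: indicator_def)
          also have "1 = min 1 ((x * u)\<^sup>2)"
            using elim by (simp add: one_le_power)
          also have "\<dots> \<le> max 1 (x\<^sup>2) * min 1 (u\<^sup>2)"
            by (rule min_square_scaled_le)
          finally show ?case
            by (auto simp: indicator_def ennreal_leI split: if_splits)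
        qed
      qed
      also have "\<dots> < \<infinity>"
        using integrable_mult_right[OF integrable_min_square[OF \<nu>], of "max 1 (x\<^sup>2)"]
        by (subst (asm) integrable_iff_bounded) (simp add: abs_mult)
      finally show False
        using inf by simp
    qed
    with nonneg have "0 < (\<integral>u. ?f u \<partial>\<nu>)"
      by (simp only: less_le) simp
    then show ?thesis
      by (simp add: truncated_variance_def add_nonneg_pos)
  qed
qed

lemma concentration_pair_levy_measure:
  assumes \<nu>: "levy_measure \<nu>" and ubv: "unbounded_variation \<sigma> \<nu>"
  shows "concentration_pair (truncated_variance \<sigma> \<nu>) (concentration \<sigma> \<nu>)"
proof
  note int = integrable_min_scaled[OF \<nu>] integrable_truncated[OF \<nu>]
  show "0 < truncated_variance \<sigma> \<nu> x" if "0 < x" for x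
    using truncated_variance_pos[OF \<nu> ubv that] .
  show "0 \<le> concentration \<sigma> \<nu> x" for x
    by (simp add: concentration_def)
  show "truncated_variance \<sigma> \<nu> y \<le> (y / x)\<^sup>2 * truncated_variance \<sigma> \<nu> x"
    if "0 < x" "x \<le> y" for x y
  proof -
    have "(\<integral>u. (if y * u \<le> 1 then (y * u)\<^sup>2 else 0) \<partial>\<nu>) \<le>
        (\<integral>u. (y / x)\<^sup>2 * (if x * u \<le> 1 then (x * u)\<^sup>2 else 0) \<partial>\<nu>)"
    proof (rule integral_mono)
      fix u assume "u \<in> space \<nu>"
      then have "x * u \<le> y * u"
        using that by (simp add: space_levy_measure[OF \<nu>])
      then show "(if y * u \<le> 1 then (y * u)\<^sup>2 else 0) \<le>
          (y / x)\<^sup>2 * (if x * u \<le> 1 then (x * u)\<^sup>2 else 0)"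
        using that by (auto simp: power_mult_distrib power_divide)
    qed (use int that in auto)
    then show ?thesis
      using that by (simp add: truncated_variance_def algebra_simps power_divide)
  qed
  show "concentration \<sigma> \<nu> x \<le> concentration \<sigma> \<nu> y" if "0 < x" "x \<le> y" for x y
    unfolding concentration_def
  proof (intro add_mono mult_left_mono integral_mono int)
    fix u assume "u \<in> space \<nu>"
    then have "(x * u)\<^sup>2 \<le> (y * u)\<^sup>2"
      using that by (intro power_mono mult_right_mono) (auto simp: space_levy_measure[OF \<nu>])
    then show "min 1 ((x * u)\<^sup>2) \<le> min 1 ((y * u)\<^sup>2)"
      by linarith
  qed (use that in \<open>auto intro: power_mono\<close>)
  show "concentration \<sigma> \<nu> (l * x) \<le> concentration \<sigma> \<nu> x + l\<^sup>2 * truncated_variance \<sigma> \<nu> x"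
    if "0 < x" "1 \<le> l" for x l
  proof -
    have "(\<integral>u. min 1 ((l * x * u)\<^sup>2) \<partial>\<nu>) \<le>
        (\<integral>u. min 1 ((x * u)\<^sup>2) + l\<^sup>2 * (if x * u \<le> 1 then (x * u)\<^sup>2 else 0) \<partial>\<nu>)"
    proof (rule integral_mono)
      fix u assume "u \<in> space \<nu>"
      then have "0 < x * u"
        using that by (simp add: space_levy_measure[OF \<nu>])
      \<comment> \<open>For \<open>x u > 1\<close> both minima equal 1, so the increment lives on \<open>x u \<le> 1\<close>.\<close>
      show "min 1 ((l * x * u)\<^sup>2) \<le>
          min 1 ((x * u)\<^sup>2) + l\<^sup>2 * (if x * u \<le> 1 then (x * u)\<^sup>2 else 0)"
      proof (cases "x * u \<le> 1")
        case True
        then show ?thesis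
          by (simp add: power_mult_distrib mult.assoc min.coboundedI2)
      next
        case False
        then have "1 \<le> (x * u)\<^sup>2"
          by (simp add: one_le_power)
        with False show ?thesis
          by simp
      qed
    qed (use int that in auto)
    also have "\<dots> = (\<integral>u. min 1 ((x * u)\<^sup>2) \<partial>\<nu>) +
        l\<^sup>2 * (\<integral>u. (if x * u \<le> 1 then (x * u)\<^sup>2 else 0) \<partial>\<nu>)"
      using int that by (simp only: Bochner_Integration.integral_add integrable_mult_right
          Bochner_Integration.integral_mult_right_zero)
    finally show ?thesis
      by (simp add: concentration_def truncated_variance_def power_mult_distrib distrib_left
          add_increasing)
  qed
  show "(concentration \<sigma> \<nu> \<longlongrightarrow> 0) (at_right 0)"
    unfolding tendsto_at_iff_sequentially comp_def
  proof (intro allI impI)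
    fix X :: "nat \<Rightarrow> real"
    assume X: "X \<longlonglongrightarrow> 0"
    then obtain B where B: "\<And>n. \<bar>X n\<bar> \<le> B"
      using convergent_imp_Bseq[of X] by (auto simp: convergent_def Bseq_def)
    have "(\<lambda>n. \<integral>u. min 1 ((X n * u)\<^sup>2) \<partial>\<nu>) \<longlonglongrightarrow> (\<integral>u. 0 \<partial>\<nu>)"
    proof (rule integral_dominated_convergence)
      show "integrable \<nu> (\<lambda>u. min 1 ((B * u)\<^sup>2))"
        by (rule int)
      show "(\<lambda>u. min 1 ((X n * u)\<^sup>2)) \<in> borel_measurable \<nu>" for n
        using int by blast
      have "(\<lambda>n. min 1 ((X n * u)\<^sup>2)) \<longlonglongrightarrow> min 1 ((0 * u)\<^sup>2)" for u
        by (intro tendsto_intros X)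
      then show "AE u in \<nu>. (\<lambda>n. min 1 ((X n * u)\<^sup>2)) \<longlonglongrightarrow> 0"
        by simp
      show "AE u in \<nu>. norm (min 1 ((X n * u)\<^sup>2)) \<le> min 1 ((B * u)\<^sup>2)" for n
      proof (rule AE_I2)
        fix u assume "u \<in> space \<nu>"
        have "(X n)\<^sup>2 \<le> B\<^sup>2"
          using B[of n] power_mono[of "\<bar>X n\<bar>" B 2] by simp
        then have "(X n * u)\<^sup>2 \<le> (B * u)\<^sup>2"
          unfolding power_mult_distrib by (rule mult_right_mono) simp
        then show "norm (min 1 ((X n * u)\<^sup>2)) \<le> min 1 ((B * u)\<^sup>2)"
          by (simp add: min_def)
      qed
    qed simp
    then have "(\<lambda>n. \<sigma>\<^sup>2 * (X n)\<^sup>2 + (\<integral>u. min 1 ((X n * u)\<^sup>2) \<partial>\<nu>)) \<longlonglongrightarrow> \<sigma>\<^sup>2 * 0\<^sup>2 + (\<integral>u. 0 \<partial>\<nu>)"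
      by (intro tendsto_intros X)
    then show "(\<lambda>n. concentration \<sigma> \<nu> (X n)) \<longlonglongrightarrow> 0"
      by (simp add: concentration_def)
  qed
qed


section \<open>Scaling of integrals against a Levy measure\<close>

text \<open>The bounds on \<open>q\<close> put \<open>Q\<close> between \<open>K / 3\<close> and \<open>2 h\<close>. The factor \<open>s\<close> absorbs the
  different Gaussian parts \<open>\<sigma>\<^sup>2 x\<^sup>2\<close> of \<open>Re \<psi> x\<close> and \<open>2 \<sigma>\<^sup>2 x\<^sup>2\<close> of \<open>x\<^sup>2 \<phi>'' x\<close>.\<close>

lemma lower_scaling_levy_integral_iff:
  assumes \<nu>: "levy_measure \<nu>" and ubv: "unbounded_variation \<sigma> \<nu>"
    and "0 < \<alpha>" "0 \<le> x0"
    and q_meas: "q \<in> borel_measurable borel"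
    and q_nonneg: "\<And>v. 0 < v \<Longrightarrow> 0 \<le> q v"
    and q_lower: "\<And>v. 0 < v \<Longrightarrow> v \<le> 1 \<Longrightarrow> v\<^sup>2 / 3 \<le> q v"
    and q_upper: "\<And>v. 0 < v \<Longrightarrow> q v \<le> 2 * min 1 (v\<^sup>2)"
    and s: "1 \<le> s" "s \<le> 2"
    and Q: "\<And>x. 0 < x \<Longrightarrow> Q x = s * (\<sigma>\<^sup>2 * x\<^sup>2) + (\<integral>u. q (x * u) \<partial>\<nu>)"
  shows "lower_scaling \<alpha> x0 Q \<longleftrightarrow> lower_scaling \<alpha> x0 (concentration \<sigma> \<nu>)"
proof -
  interpret concentration_pair "truncated_variance \<sigma> \<nu>" "concentration \<sigma> \<nu>"
    by (rule concentration_pair_levy_measure[OF \<nu> ubv])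
  have int: "integrable \<nu> (\<lambda>u. q (x * u))" if "0 < x" for x
  proof (rule integrable_levy_measure[OF \<nu>, of _ "2 * max 1 (x\<^sup>2)"])
    show "(\<lambda>u. q (x * u)) \<in> borel_measurable borel"
      using q_meas by measurable
    show "norm (q (x * u)) \<le> 2 * max 1 (x\<^sup>2) * min 1 (u\<^sup>2)" if "0 < u" for u
      using q_nonneg[of "x * u"] q_upper[of "x * u"] min_square_scaled_le[of x u] that \<open>0 < x\<close>
      by simp
  qed
  show ?thesis
  proof (rule lower_scaling_iff)
    show "1 / 3 * truncated_variance \<sigma> \<nu> x \<le> Q x" if "0 < x" for x
    proof -
      have "(\<integral>u. 1 / 3 * (if x * u \<le> 1 then (x * u)\<^sup>2 else 0) \<partial>\<nu>) \<le> (\<integral>u. q (x * u) \<partial>\<nu>)"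
      proof (rule integral_mono)
        fix u assume "u \<in> space \<nu>"
        then have "0 < x * u"
          using that by (simp add: space_levy_measure[OF \<nu>])
        then show "1 / 3 * (if x * u \<le> 1 then (x * u)\<^sup>2 else 0) \<le> q (x * u)"
          using q_nonneg q_lower by simp
      qed (use int[OF that] integrable_truncated[OF \<nu> that] in auto)
      moreover have "1 / 3 * (\<sigma>\<^sup>2 * x\<^sup>2) \<le> s * (\<sigma>\<^sup>2 * x\<^sup>2)"
        using s by (intro mult_right_mono) auto
      ultimately show ?thesis
        using that by (simp add: Q truncated_variance_def)
    qed
    show "Q x \<le> 2 * concentration \<sigma> \<nu> x" if "0 < x" for x
    proof -
      have "(\<integral>u. q (x * u) \<partial>\<nu>) \<le> (\<integral>u. 2 * min 1 ((x * u)\<^sup>2) \<partial>\<nu>)"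
      proof (rule integral_mono)
        fix u assume "u \<in> space \<nu>"
        then have "0 < x * u"
          using that by (simp add: space_levy_measure[OF \<nu>])
        then show "q (x * u) \<le> 2 * min 1 ((x * u)\<^sup>2)"
          by (rule q_upper)
      qed (use int[OF that] integrable_min_scaled[OF \<nu>] in auto)
      moreover have "s * (\<sigma>\<^sup>2 * x\<^sup>2) \<le> 2 * (\<sigma>\<^sup>2 * x\<^sup>2)"
        using s by (intro mult_right_mono) auto
      ultimately show ?thesis
        using that by (simp add: Q concentration_def)
    qed
  qed (use assms in auto)
qed


section \<open>The real part of the characteristic exponent\<close>

text \<open>The lower bound comes from \<open>1 - cos v \<ge> v\<^sup>2 / 2 - v\<^sup>3 / 6\<close>. Far beyond \<open>v = 1\<close> no positive lower bound
  is left, since the cosine returns to 1.\<close>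

lemma one_minus_cos_bounds:
  fixes v :: real
  shows "0 \<le> v \<Longrightarrow> v \<le> 1 \<Longrightarrow> v\<^sup>2 / 3 \<le> 1 - cos v" and "1 - cos v \<le> 2 * min 1 (v\<^sup>2)"
proof -
  assume v: "0 \<le> v" "v \<le> 1"
  have "cmod (iexp v - (\<Sum>k\<le>2. (\<i> * v) ^ k / fact k)) \<le> v ^ 3 / 6"
    using iexp_approx1[of v 2] v by (simp add: eval_nat_numeral)
  then have "\<bar>Re (iexp v - (\<Sum>k\<le>2. (\<i> * v) ^ k / fact k))\<bar> \<le> v ^ 3 / 6"
    using abs_Re_le_cmod order_trans by blast
  also have "Re (iexp v - (\<Sum>k\<le>2. (\<i> * v) ^ k / fact k)) = cos v - 1 + v\<^sup>2 / 2"
    by (simp add: eval_nat_numeral Re_exp)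
  also have "v ^ 3 / 6 \<le> v\<^sup>2 / 6"
    using v by (intro divide_right_mono power_decreasing) auto
  finally show "v\<^sup>2 / 3 \<le> 1 - cos v"
    by linarith
next
  have "1 - cos v = 2 * (sin (v / 2))\<^sup>2"
    using cos_double_sin[of "v / 2"] by simp
  moreover have "(sin (v / 2))\<^sup>2 \<le> (v / 2)\<^sup>2"
    by (rule iffD1[OF abs_le_square_iff abs_sin_x_le_abs_x])
  moreover have "(v / 2)\<^sup>2 \<le> v\<^sup>2"
    by (simp add: power_divide)
  moreover have "(sin (v / 2))\<^sup>2 \<le> 1"
    by (simp add: abs_square_le_1)
  ultimately show "1 - cos v \<le> 2 * min 1 (v\<^sup>2)"
    by linarith
qed

text \<open>The drift and the compensator are purely imaginary. The integral converges because the compensated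
  integrand is \<open>O(u\<^sup>2)\<close> at 0 and bounded at infinity.\<close>

lemma Re_char_exponent:
  assumes \<nu>: "levy_measure \<nu>"
  shows "Re (char_exponent \<sigma> b \<nu> \<xi>) = \<sigma>\<^sup>2 * \<xi>\<^sup>2 + (\<integral>u. 1 - cos (\<xi> * u) \<partial>\<nu>)"
proof -
  let ?f = "\<lambda>u :: real. exp (\<i> * of_real (\<xi> * u)) - 1 - \<i> * of_real (\<xi> * u * indicator {..<1} u)"
  have int: "integrable \<nu> ?f"
  proof (rule integrable_levy_measure[OF \<nu>, of _ "max 2 (\<xi>\<^sup>2)"])
    show "?f \<in> borel_measurable borel"
      by measurable
    show "norm (?f u) \<le> max 2 (\<xi>\<^sup>2) * min 1 (u\<^sup>2)" if "0 < u" for u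
    proof (cases "u < 1")
      case True
      then have "norm (?f u) \<le> (\<xi> * u)\<^sup>2 / 2"
        using iexp_approx1[of "\<xi> * u" 1] by (simp add: eval_nat_numeral diff_diff_eq)
      also have "\<dots> \<le> (\<xi> * u)\<^sup>2"
        by simp
      also have "\<dots> \<le> max 2 (\<xi>\<^sup>2) * u\<^sup>2"
        unfolding power_mult_distrib by (rule mult_right_mono) auto
      also have "u\<^sup>2 = min 1 (u\<^sup>2)"
        using True that by (simp add: power_le_one)
      finally show ?thesis .
    next
      case False
      then have "norm (?f u) = norm (iexp (\<xi> * u) - 1)"
        by simp
      also have "\<dots> \<le> 2"
        using norm_triangle_ineq4[of "iexp (\<xi> * u)" 1] by simp
      also have "\<dots> \<le> max 2 (\<xi>\<^sup>2) * min 1 (u\<^sup>2)"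
        using False by (simp add: one_le_power)
      finally show ?thesis .
    qed
  qed
  have "Re (\<integral>u. ?f u \<partial>\<nu>) = (\<integral>u. Re (?f u) \<partial>\<nu>)"
    by (rule integral_Re[OF int, symmetric])
  also have "\<dots> = (\<integral>u. - (1 - cos (\<xi> * u)) \<partial>\<nu>)"
    by (simp add: Re_exp)
  also have "\<dots> = - (\<integral>u. 1 - cos (\<xi> * u) \<partial>\<nu>)"
    by (rule Bochner_Integration.integral_minus)
  finally show ?thesis
    by (simp add: char_exponent_def)
qed


section \<open>The second derivative of the Laplace exponent\<close>

text \<open>By the mean value theorem the difference quotients are dominated by \<open>w\<close>, so dominated convergence
  applies along every sequence tending to \<open>x\<close>.\<close>

lemma has_field_derivative_integral:
  fixes f f' :: "real \<Rightarrow> 'a \<Rightarrow> real"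
  assumes x: "x \<in> {a<..<b}"
    and f: "\<And>y. y \<in> {a<..<b} \<Longrightarrow> integrable M (f y)"
    and f'_meas: "f' x \<in> borel_measurable M"
    and deriv: "\<And>y u. y \<in> {a<..<b} \<Longrightarrow> u \<in> space M \<Longrightarrow>
      ((\<lambda>y. f y u) has_field_derivative f' y u) (at y)"
    and w: "integrable M w"
    and bound: "\<And>y u. y \<in> {a<..<b} \<Longrightarrow> u \<in> space M \<Longrightarrow> \<bar>f' y u\<bar> \<le> w u"
  shows "((\<lambda>y. \<integral>u. f y u \<partial>M) has_field_derivative (\<integral>u. f' x u \<partial>M)) (at x)"
proof -
  have "((\<lambda>y. ((\<integral>u. f y u \<partial>M) - (\<integral>u. f x u \<partial>M)) / (y - x)) \<longlongrightarrow> (\<integral>u. f' x u \<partial>M)) (at x within {a<..<b})"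
    unfolding tendsto_at_iff_sequentially comp_def
  proof (intro allI impI)
    fix X :: "nat \<Rightarrow> real"
    assume X: "\<forall>i. X i \<in> {a<..<b} - {x}" and X_lim: "X \<longlonglongrightarrow> x"
    have "(\<lambda>i. \<integral>u. (f (X i) u - f x u) / (X i - x) \<partial>M) \<longlonglongrightarrow> (\<integral>u. f' x u \<partial>M)"
    proof (rule integral_dominated_convergence)
      show "f' x \<in> borel_measurable M"
        by (rule f'_meas)
      show "(\<lambda>u. (f (X i) u - f x u) / (X i - x)) \<in> borel_measurable M" for i
        using f[of "X i"] f[OF x] X by (intro borel_measurable_divide borel_measurable_diff) auto
      show "integrable M w"
        by (rule w)
      show "AE u in M. (\<lambda>i. (f (X i) u - f x u) / (X i - x)) \<longlonglongrightarrow> f' x u"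
      proof (rule AE_I2)
        fix u assume "u \<in> space M"
        have "filterlim X (at x) sequentially"
          using X X_lim by (auto simp: filterlim_at)
        moreover have "((\<lambda>y. (f y u - f x u) / (y - x)) \<longlongrightarrow> f' x u) (at x)"
          using deriv[OF x \<open>u \<in> space M\<close>] by (simp add: has_field_derivative_iff)
        ultimately show "(\<lambda>i. (f (X i) u - f x u) / (X i - x)) \<longlonglongrightarrow> f' x u"
          by (rule filterlim_compose[rotated])
      qed
      show "AE u in M. norm ((f (X i) u - f x u) / (X i - x)) \<le> w u" for i
      proof (rule AE_I2)
        fix u assume u: "u \<in> space M"
        have "norm (f (X i) u - f x u) \<le> w u * norm (X i - x)"
        proof (rule field_differentiable_bound)
          show "convex {a<..<b}"
            by simp
          show "((\<lambda>y. f y u) has_field_derivative f' y u) (at y within {a<..<b})"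
            if "y \<in> {a<..<b}" for y
            using deriv[OF that u] by (rule has_field_derivative_at_within)
        qed (use bound u X x in auto)
        then show "norm ((f (X i) u - f x u) / (X i - x)) \<le> w u"
          using X by (simp add: divide_simps)
      qed
    qed
    moreover have "(\<integral>u. (f (X i) u - f x u) / (X i - x) \<partial>M) =
        ((\<integral>u. f (X i) u \<partial>M) - (\<integral>u. f x u \<partial>M)) / (X i - x)" for i
      using f[of "X i"] f[OF x] X by simp
    ultimately show "(\<lambda>i. ((\<integral>u. f (X i) u \<partial>M) - (\<integral>u. f x u \<partial>M)) / (X i - x))
        \<longlonglongrightarrow> (\<integral>u. f' x u \<partial>M)"
      by (simp only:)
  qed
  then show ?thesis
    using x by (simp add: has_field_derivative_iff at_within_open[OF x])
qed

lemma square_times_exp_bounds: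
  fixes v :: real
  assumes "0 \<le> v"
  shows "v \<le> 1 \<Longrightarrow> v\<^sup>2 / 3 \<le> v\<^sup>2 * exp (- v)" and "v\<^sup>2 * exp (- v) \<le> 2 * min 1 (v\<^sup>2)"
proof -
  assume "v \<le> 1"
  then have "exp v \<le> exp 1"
    by simp
  then have "exp v \<le> 3"
    using exp_le by linarith
  then have "1 / 3 \<le> exp (- v)"
    by (simp add: exp_minus field_simps)
  then show "v\<^sup>2 / 3 \<le> v\<^sup>2 * exp (- v)"
    using mult_left_mono[of "1 / 3" "exp (- v)" "v\<^sup>2"] by simp
next
  have "v\<^sup>2 / 2 \<le> exp v"
    using exp_lower_Taylor_quadratic[OF assms] assms by linarith
  then have "v\<^sup>2 * exp (- v) \<le> 2"
    by (simp add: exp_minus field_simps)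
  moreover have "v\<^sup>2 * exp (- v) \<le> v\<^sup>2 * 1"
    using assms by (intro mult_left_mono) auto
  ultimately show "v\<^sup>2 * exp (- v) \<le> 2 * min 1 (v\<^sup>2)"
    using zero_le_power2[of v] by linarith
qed

text \<open>For \<open>u < 1\<close> and \<open>v = l u\<close> the claim is \<open>0 \<le> exp (- v) - 1 + v \<le> v\<^sup>2\<close>. The upper half follows from
  \<open>exp (- v) \<le> 1 / (1 + v)\<close> and \<open>(1 - v + v\<^sup>2) (1 + v) = 1 + v\<^sup>3\<close>.\<close>

lemma laplace_integrand_bound:
  fixes l u :: real
  assumes "0 \<le> l" "0 < u"
  shows "\<bar>exp (- l * u) - 1 + l * u * indicator {..<1} u\<bar> \<le> max 1 (l\<^sup>2) * min 1 (u\<^sup>2)"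
proof (cases "u < 1")
  case True
  define v where "v = l * u"
  have v: "0 \<le> v"
    using assms by (simp add: v_def)
  have "1 \<le> (1 - v + v\<^sup>2) * (1 + v)"
    using v by (simp add: algebra_simps power2_eq_square)
  also have "\<dots> \<le> (1 - v + v\<^sup>2) * exp v"
  proof (rule mult_left_mono)
    have "1 - v + v\<^sup>2 = (v - 1 / 2)\<^sup>2 + 3 / 4"
      by (simp add: power2_eq_square algebra_simps)
    then show "0 \<le> 1 - v + v\<^sup>2"
      by simp
  qed simp
  finally have "exp (- v) \<le> 1 - v + v\<^sup>2"
    by (simp add: exp_minus field_simps)
  moreover have "1 - v \<le> exp (- v)"
    using exp_ge_add_one_self[of "- v"] by simp
  ultimately have "\<bar>exp (- v) - 1 + v\<bar> \<le> l\<^sup>2 * u\<^sup>2"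
    by (simp add: v_def power_mult_distrib)
  also have "\<dots> \<le> max 1 (l\<^sup>2) * u\<^sup>2"
    by (rule mult_right_mono) auto
  also have "u\<^sup>2 = min 1 (u\<^sup>2)"
    using True assms by (simp add: power_le_one)
  finally show ?thesis
    using True by (simp add: v_def)
next
  case False
  have "\<bar>exp (- l * u) - 1\<bar> \<le> 1"
    using assms by (simp add: abs_le_iff)
  also have "\<dots> \<le> max 1 (l\<^sup>2) * min 1 (u\<^sup>2)"
    using False by (simp add: one_le_power)
  finally show ?thesis
    using False by simp
qed

lemma laplace_integrand_deriv_bound:
  fixes l u :: real
  assumes "0 < l" "0 < u"
  shows "\<bar>u * indicator {..<1} u - u * exp (- l * u)\<bar> \<le> max l (1 / l) * min 1 (u\<^sup>2)"
proof (cases "u < 1")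
  case True
  have "u * (1 - exp (- l * u)) \<le> u * (l * u)"
    using assms exp_ge_add_one_self[of "- l * u"] by (intro mult_left_mono) auto
  moreover have "0 \<le> u * (1 - exp (- l * u))"
    using assms by simp
  ultimately have "\<bar>u - u * exp (- l * u)\<bar> \<le> l * u\<^sup>2"
    by (simp add: algebra_simps power2_eq_square)
  also have "\<dots> \<le> max l (1 / l) * u\<^sup>2"
    by (rule mult_right_mono) auto
  also have "u\<^sup>2 = min 1 (u\<^sup>2)"
    using True assms by (simp add: power_le_one)
  finally show ?thesis
    using True by simp
next
  case False
  have "l * u \<le> exp (l * u)"
    using exp_ge_add_one_self[of "l * u"] by linarith
  then have "u * exp (- l * u) \<le> 1 / l"
    using assms by (simp add: exp_minus field_simps)
  also have "\<dots> \<le> max l (1 / l) * min 1 (u\<^sup>2)"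
    using False by (simp add: one_le_power)
  finally show ?thesis
    using False assms by simp
qed

lemma laplace_integrand_deriv2_bound:
  fixes l u :: real
  assumes "0 < l" "0 < u"
  shows "u\<^sup>2 * exp (- l * u) \<le> 2 * max 1 (1 / l\<^sup>2) * min 1 (u\<^sup>2)"
proof -
  have "(l * u)\<^sup>2 * exp (- (l * u)) \<le> 2 * min 1 ((l * u)\<^sup>2)"
    using assms by (intro square_times_exp_bounds) simp
  also have "\<dots> \<le> 2 * (max 1 (l\<^sup>2) * min 1 (u\<^sup>2))"
    using min_square_scaled_le by (intro mult_left_mono) auto
  also have "max 1 (l\<^sup>2) = l\<^sup>2 * max 1 (1 / l\<^sup>2)"
    using assms by (simp add: max_def field_simps)
  finally have "l\<^sup>2 * (u\<^sup>2 * exp (- l * u)) \<le> l\<^sup>2 * (2 * max 1 (1 / l\<^sup>2) * min 1 (u\<^sup>2))"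
    by (simp add: power_mult_distrib mult_ac)
  then show ?thesis
    by (rule mult_left_le_imp_le) (use assms in simp)
qed

text \<open>Two differentiations under the integral sign. On \<open>(l / 2, 2 l)\<close> the constants in the preceding
  bounds are controlled uniformly, which gives a dominating multiple of \<open>min 1 (u\<^sup>2)\<close>.\<close>

lemma deriv2_laplace_exponent:
  assumes \<nu>: "levy_measure \<nu>" and "0 < l"
  shows "deriv (deriv (laplace_exponent \<sigma> b \<nu>)) l = 2 * \<sigma>\<^sup>2 + (\<integral>u. u\<^sup>2 * exp (- l * u) \<partial>\<nu>)"
proof -
  let ?g = "\<lambda>l u :: real. u * indicator {..<1} u - u * exp (- l * u)"
  have \<nu>_meas: "f \<in> borel_measurable \<nu>" if "f \<in> borel_measurable borel" for f :: "real \<Rightarrow> real"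
    using borel_measurable_levy_measure[OF \<nu> that] .
  have int_f: "integrable \<nu> (\<lambda>u. exp (- l * u) - 1 + l * u * indicator {..<1} u)" if "0 < l" for l
    by (rule integrable_levy_measure[OF \<nu>, of _ "max 1 (l\<^sup>2)"])
       (use laplace_integrand_bound that in auto)
  have int_g: "integrable \<nu> (?g l)" if "0 < l" for l
    by (rule integrable_levy_measure[OF \<nu>, of _ "max l (1 / l)"])
       (use laplace_integrand_deriv_bound that in auto)
  have d1: "deriv (laplace_exponent \<sigma> b \<nu>) l = 2 * \<sigma>\<^sup>2 * l - b + (\<integral>u. ?g l u \<partial>\<nu>)" if "0 < l" for l
  proof (rule DERIV_imp_deriv)
    have "((\<lambda>l. \<integral>u. exp (- l * u) - 1 + l * u * indicator {..<1} u \<partial>\<nu>)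
        has_field_derivative (\<integral>u. ?g l u \<partial>\<nu>)) (at l)"
    proof (rule has_field_derivative_integral[where w = "\<lambda>u. max (2 * l) (2 / l) * min 1 (u\<^sup>2)"])
      show "l \<in> {l / 2<..<2 * l}"
        using that by simp
      show "integrable \<nu> (\<lambda>u. exp (- y * u) - 1 + y * u * indicator {..<1} u)"
        if "y \<in> {l / 2<..<2 * l}" for y
        using that \<open>0 < l\<close> by (intro int_f) auto
      show "?g l \<in> borel_measurable \<nu>"
        by (rule \<nu>_meas) measurable
      show "((\<lambda>y. exp (- y * u) - 1 + y * u * indicator {..<1} u) has_field_derivative ?g y u) (at y)"
        for y u
        by (auto intro!: derivative_eq_intros)
      show "integrable \<nu> (\<lambda>u. max (2 * l) (2 / l) * min 1 (u\<^sup>2))"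
        by (intro integrable_mult_right integrable_min_square \<nu>)
      show "\<bar>?g y u\<bar> \<le> max (2 * l) (2 / l) * min 1 (u\<^sup>2)"
        if "y \<in> {l / 2<..<2 * l}" "u \<in> space \<nu>" for y u
      proof -
        have y: "0 < y" "y \<le> 2 * l" "1 / y \<le> 2 / l"
          using that \<open>0 < l\<close> by (auto simp: field_simps)
        have "\<bar>?g y u\<bar> \<le> max y (1 / y) * min 1 (u\<^sup>2)"
          using that y by (intro laplace_integrand_deriv_bound) (auto simp: space_levy_measure[OF \<nu>])
        also have "\<dots> \<le> max (2 * l) (2 / l) * min 1 (u\<^sup>2)"
          using y by (intro mult_right_mono max.mono) auto
        finally show ?thesis .
      qed
    qed
    then show "(laplace_exponent \<sigma> b \<nu> has_field_derivative 2 * \<sigma>\<^sup>2 * l - b + (\<integral>u. ?g l u \<partial>\<nu>)) (at l)"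
      unfolding laplace_exponent_def[abs_def]
      by (auto intro!: derivative_eq_intros)
  qed
  have "((\<lambda>l. \<integral>u. ?g l u \<partial>\<nu>) has_field_derivative (\<integral>u. u\<^sup>2 * exp (- l * u) \<partial>\<nu>)) (at l)"
  proof (rule has_field_derivative_integral[where w = "\<lambda>u. 2 * max 1 (4 / l\<^sup>2) * min 1 (u\<^sup>2)"])
    show "l \<in> {l / 2<..<2 * l}"
      using \<open>0 < l\<close> by simp
    show "integrable \<nu> (?g y)" if "y \<in> {l / 2<..<2 * l}" for y
      using that \<open>0 < l\<close> by (intro int_g) auto
    show "(\<lambda>u. u\<^sup>2 * exp (- l * u)) \<in> borel_measurable \<nu>"
      by (rule \<nu>_meas) measurable
    show "((\<lambda>y. ?g y u) has_field_derivative u\<^sup>2 * exp (- y * u)) (at y)" for y u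
      by (auto intro!: derivative_eq_intros simp: power2_eq_square)
    show "integrable \<nu> (\<lambda>u. 2 * max 1 (4 / l\<^sup>2) * min 1 (u\<^sup>2))"
      by (intro integrable_mult_right integrable_min_square \<nu>)
    show "\<bar>u\<^sup>2 * exp (- y * u)\<bar> \<le> 2 * max 1 (4 / l\<^sup>2) * min 1 (u\<^sup>2)"
      if "y \<in> {l / 2<..<2 * l}" "u \<in> space \<nu>" for y u
    proof -
      have y: "0 < y" "1 / y \<le> 2 / l"
        using that \<open>0 < l\<close> by (auto simp: field_simps)
      have "(1 / y)\<^sup>2 \<le> (2 / l)\<^sup>2"
        using y by (intro power_mono) auto
      then have y2: "1 / y\<^sup>2 \<le> 4 / l\<^sup>2"
        by (simp add: power_divide)
      have "\<bar>u\<^sup>2 * exp (- y * u)\<bar> \<le> 2 * max 1 (1 / y\<^sup>2) * min 1 (u\<^sup>2)"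
        using laplace_integrand_deriv2_bound[of y u] that y by (simp add: space_levy_measure[OF \<nu>])
      also have "\<dots> \<le> 2 * max 1 (4 / l\<^sup>2) * min 1 (u\<^sup>2)"
        using y2 by (intro mult_right_mono mult_left_mono max.mono) auto
      finally show ?thesis .
    qed
  qed
  then have "((\<lambda>l. 2 * \<sigma>\<^sup>2 * l - b + (\<integral>u. ?g l u \<partial>\<nu>)) has_field_derivative
      2 * \<sigma>\<^sup>2 + (\<integral>u. u\<^sup>2 * exp (- l * u) \<partial>\<nu>)) (at l)"
    by (auto intro!: derivative_eq_intros)
  then have "(deriv (laplace_exponent \<sigma> b \<nu>) has_field_derivative
      2 * \<sigma>\<^sup>2 + (\<integral>u. u\<^sup>2 * exp (- l * u) \<partial>\<nu>)) (at l)"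
    by (rule has_field_derivative_transform_within_open[where S = "{0<..}"])
       (use d1 \<open>0 < l\<close> in auto)
  then show ?thesis
    by (rule DERIV_imp_deriv)
qed


section \<open>Equivalence of the two scaling conditions\<close>

theorem corollary4p3:
  fixes M :: "'a measure" and X :: "real \<Rightarrow> 'a \<Rightarrow> real"
    and \<sigma> b :: real and \<nu> :: "real measure" and x0 \<alpha> :: real
  assumes "spectrally_positive_levy_process M X"
    and "levy_triplet M X \<sigma> b \<nu>"
    and "unbounded_variation \<sigma> \<nu>"
    and "x0 \<ge> 0" and "\<alpha> > 0"
  shows "(\<exists>c. 0 < c \<and> c \<le> 1 \<and> deriv (deriv (laplace_exponent \<sigma> b \<nu>)) \<in> WLSC (\<alpha> - 2) c x0)
     \<longleftrightarrow> (\<exists>c. 0 < c \<and> c \<le> 1 \<and> (\<lambda>\<xi>. Re (char_exponent \<sigma> b \<nu> \<xi>)) \<in> WLSC \<alpha> c x0)"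
proof -
  have \<nu>: "levy_measure \<nu>"
    using assms(2) by (simp add: levy_triplet_def)
  let ?\<phi>'' = "deriv (deriv (laplace_exponent \<sigma> b \<nu>))"
  have "lower_scaling \<alpha> x0 (\<lambda>x. x\<^sup>2 * ?\<phi>'' x) \<longleftrightarrow> lower_scaling \<alpha> x0 (concentration \<sigma> \<nu>)"
  proof (rule lower_scaling_levy_integral_iff[where s = 2 and q = "\<lambda>v. v\<^sup>2 * exp (- v)"])
    fix x :: real assume "0 < x"
    have "x\<^sup>2 * (\<integral>u. u\<^sup>2 * exp (- x * u) \<partial>\<nu>) = (\<integral>u. x\<^sup>2 * (u\<^sup>2 * exp (- x * u)) \<partial>\<nu>)"
      by (rule Bochner_Integration.integral_mult_right_zero[symmetric])
    also have "\<dots> = (\<integral>u. (x * u)\<^sup>2 * exp (- (x * u)) \<partial>\<nu>)"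
      by (simp add: power_mult_distrib mult_ac)
    finally show "x\<^sup>2 * ?\<phi>'' x = 2 * (\<sigma>\<^sup>2 * x\<^sup>2) + (\<integral>u. (x * u)\<^sup>2 * exp (- (x * u)) \<partial>\<nu>)"
      using deriv2_laplace_exponent[OF \<nu> \<open>0 < x\<close>] by (simp add: algebra_simps)
  qed (use \<nu> assms square_times_exp_bounds in auto)
  moreover have "lower_scaling \<alpha> x0 (\<lambda>\<xi>. Re (char_exponent \<sigma> b \<nu> \<xi>)) \<longleftrightarrow>
      lower_scaling \<alpha> x0 (concentration \<sigma> \<nu>)"
  proof (rule lower_scaling_levy_integral_iff[where s = 1 and q = "\<lambda>v. 1 - cos v"])
    show "Re (char_exponent \<sigma> b \<nu> x) = 1 * (\<sigma>\<^sup>2 * x\<^sup>2) + (\<integral>u. 1 - cos (x * u) \<partial>\<nu>)" for x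
      using Re_char_exponent[OF \<nu>] by simp
  qed (use \<nu> assms one_minus_cos_bounds in auto)
  ultimately show ?thesis
    using square_times_WLSC_iff[OF \<open>x0 \<ge> 0\<close>] by (simp add: lower_scaling_def)
qed

end
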